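(* Let $\beta\in(0,1)$ and $0<\epsilon<x^*<x_0$ be real numbers, and let $g:\mathbb{R}_+\to\mathbb{R}$ be a function such that, for all $x\in\mathbb{R}_+$, $g(x)\le 0$ if $x\le x^*$ and $g(x)>0$ if $x>x^*$. Then the fast-tracking algorithm with input $g,\epsilon,x_0,\beta$ and with the choice $\tilde{x}=\sqrt{ab}$ at every iteration finds a solution $\hat{x}$ such that $g(\hat{x})\le 0$ in at most $\lceil \log_2\log_\beta(\epsilon/x_0)\rceil$ iterations, and the solution $\hat{x}$ satisfies $\beta x^*<\hat{x}\le x^*$.
   Context: The fast-tracking algorithm with input $g$, $\epsilon$, $x_0$, $\beta$ is the following. Set $a\leftarrow\epsilon$ and $b\leftarrow x_0$. While $a<\beta b$, perform one iteration: choose $\tilde{x}\in(a,b)$ (here $\tilde{x}=\sqrt{ab}$), evaluate $g(\tilde{x})$, and update $(a,b)$ by the rule: $a\leftarrow\tilde{x}$ if $g(\tilde{x})<0$; $b\leftarrow\tilde{x}$ if $g(\tilde{x})>0$; both $a\leftarrow\tilde{x}$ and $b\leftarrow\tilde{x}$ if $g(\tilde{x})=0$. When the loop ends, return $\hat{x}=a$. An iteration is one execution of the loop body (one evaluation of $g$). Here $\log_\beta$ is the logarithm to base $\beta$: $\log_\beta y=\ln y/\ln\beta$.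
   Formalization: The iteration bound is read as 0 when the ceiling is negative, and βx* < x̂ is claimed only if g has no zero in (ε, βx*]; without this it fails, e.g. β=0.9, ε=1, x*=50, x₀=100, g=0 on x≤50 and g=1 above gives x̂=10. *)

theory Defs
  imports Complex_Main "HOL-Library.While_Combinator"
begin

definition ft_update :: "(real \<Rightarrow> real) \<Rightarrow> real \<Rightarrow> real \<times> real \<Rightarrow> real \<times> real" where
  "ft_update g x = (\<lambda>(a, b).
     if g x < 0 then (x, b) else if g x > 0 then (a, x) else (x, x))"

text \<open>
  The argument \<open>pick\<close> is the rule selecting the evaluation point from the current \<open>a\<close> and \<open>b\<close>.
  The loop state carries, besides \<open>(a, b)\<close>, the number of executions of the loop body;
  the result \<open>Some (xhat, n)\<close> says that the loop ends after exactly \<open>n\<close> iterations with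
  \<open>xhat\<close> returned, and \<open>None\<close> that it does not terminate.
\<close>

definition fast_tracking ::
  "(real \<Rightarrow> real \<Rightarrow> real) \<Rightarrow> (real \<Rightarrow> real) \<Rightarrow> real \<Rightarrow> real \<Rightarrow> real \<Rightarrow> (real \<times> nat) option" where
  "fast_tracking pick g \<epsilon> x\<^sub>0 \<beta> =
     map_option (\<lambda>((a, b), n). (a, n))
       (while_option
         (\<lambda>((a, b), n). a < \<beta> * b)
         (\<lambda>((a, b), n). (ft_update g (pick a b) (a, b), Suc n))
         ((\<epsilon>, x\<^sub>0), 0))"

end

theory Submission
  imports Defs
begin

text \<open>
  The geometric mean halves \<open>ln (b / a)\<close>, and the loop runs only as long as
  \<open>ln (b / a) > - ln \<beta>\<close>. Since \<open>log\<^sub>\<beta> (\<epsilon> / x\<^sub>0)\<close> is the initial value of \<open>ln (b / a)\<close> divided by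
  \<open>- ln \<beta>\<close>, entering the loop after \<open>n\<close> iterations forces \<open>2 ^ n < log\<^sub>\<beta> (\<epsilon> / x\<^sub>0)\<close>.
\<close>

text \<open>On the logarithmic scale \<open>sqrt (a * b)\<close> is the midpoint of \<open>a\<close>
  and \<open>b\<close>, so the halving does not depend on which endpoint moves.\<close>

lemma ln_sqrt_mult_divide:
  fixes a b :: real
  assumes "0 < a" and "0 < b"
  shows "ln (sqrt (a * b) / a) = ln (b / a) / 2" and "ln (b / sqrt (a * b)) = ln (b / a) / 2"
  using assms by (simp_all add: ln_div ln_sqrt ln_mult field_simps)

lemma sqrt_mult_between:
  fixes a b :: real
  assumes "0 < a" and "a < b"
  shows "a < sqrt (a * b)" and "sqrt (a * b) < b"
  using assms by (auto intro!: real_less_rsqrt real_less_lsqrt simp: power2_eq_square)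

text \<open>Meant for \<open>r = a / b\<close> and \<open>s = \<epsilon> / x\<^sub>0\<close>:
  \<open>r < \<beta>\<close> is then the loop guard, and the last hypothesis says that
  \<open>n\<close> halvings have taken place. Strictness leaves room for one more iteration.\<close>

lemma bisection_step_count:
  fixes \<beta> r s :: real
  assumes "0 < \<beta>" and "\<beta> < 1" and "0 < r" and "0 < s"
    and "r < \<beta>" and "- ln r * 2 ^ n \<le> - ln s"
  shows "int n < \<lceil>log 2 (log \<beta> s)\<rceil>"
proof -
  have "ln \<beta> < 0"
    using assms by simp
  have "ln r < ln \<beta>"
    using assms by simp
  then have "- ln \<beta> * 2 ^ n < - ln r * 2 ^ n"
    by simp
  then have "ln s < ln \<beta> * 2 ^ n"
    using assms(6) by linarith
  then have "2 ^ n < log \<beta> s"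
    \<comment> \<open>Dividing by the negative number \<open>ln \<beta>\<close> reverses the
      inequality.\<close>
    using \<open>ln \<beta> < 0\<close> by (simp add: log_def field_simps)
  then have "real n < log 2 (log \<beta> s)"
    by (smt (verit) less_log_of_power zero_less_power)
  then show ?thesis
    by linarith
qed

text \<open>The alternative \<open>a = b\<close> covers the collapse after an exact zero of
  \<open>g\<close> is hit, where \<open>xstar < b\<close> is lost; \<open>\<epsilon> < a\<close>
  records that this zero was an evaluation point and not the initial left end. The
  \<open>max 0\<close> is for inputs whose ceiling is negative, where the invariant must still hold
  at \<open>n = 0\<close>.\<close>

definition ft_invariant ::
  "(real \<Rightarrow> real) \<Rightarrow> real \<Rightarrow> real \<Rightarrow> real \<Rightarrow> real \<Rightarrow> (real \<times> real) \<times> nat \<Rightarrow> bool" where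
  "ft_invariant g xstar \<epsilon> x\<^sub>0 \<beta> = (\<lambda>((a, b), n).
     \<epsilon> \<le> a \<and> a \<le> xstar \<and> a \<le> b \<and> (xstar < b \<or> a = b \<and> \<epsilon> < a \<and> g a = 0) \<and>
     ln (b / a) * 2 ^ n \<le> ln (x\<^sub>0 / \<epsilon>) \<and> int n \<le> max 0 \<lceil>log 2 (log \<beta> (\<epsilon> / x\<^sub>0))\<rceil>)"

lemma ft_invariant_count:
  assumes "0 < \<beta>" and "\<beta> < 1" and "0 < \<epsilon>" and "0 < x\<^sub>0"
    and "ft_invariant g xstar \<epsilon> x\<^sub>0 \<beta> ((a, b), n)" and "a < \<beta> * b"
  shows "int n < \<lceil>log 2 (log \<beta> (\<epsilon> / x\<^sub>0))\<rceil>"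
proof (rule bisection_step_count)
  have ab: "0 < a" "0 < b" and le: "ln (b / a) * 2 ^ n \<le> ln (x\<^sub>0 / \<epsilon>)"
    using assms by (auto simp: ft_invariant_def)
  show "0 < a / b" "a / b < \<beta>"
    using ab assms by (simp_all add: field_simps)
  show "- ln (a / b) * 2 ^ n \<le> - ln (\<epsilon> / x\<^sub>0)"
    using le ab assms by (simp add: ln_div)
qed (use assms in auto)

lemma ft_invariant_step:
  assumes "0 < \<beta>" and "\<beta> < 1" and "0 < \<epsilon>" and "0 < x\<^sub>0"
    and nonpos: "\<And>x. 0 < x \<Longrightarrow> x \<le> xstar \<Longrightarrow> g x \<le> 0"
    and pos: "\<And>x. 0 < x \<Longrightarrow> xstar < x \<Longrightarrow> g x > 0"
    and inv: "ft_invariant g xstar \<epsilon> x\<^sub>0 \<beta> ((a, b), n)" and less: "a < \<beta> * b"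
  shows "ft_invariant g xstar \<epsilon> x\<^sub>0 \<beta> (ft_update g (sqrt (a * b)) (a, b), Suc n)"
proof -
  define x where "x = sqrt (a * b)"
  have a: "\<epsilon> \<le> a" "a \<le> xstar" "a \<le> b" and ab: "0 < a" "0 < b"
    and le: "ln (b / a) * 2 ^ n \<le> ln (x\<^sub>0 / \<epsilon>)"
    using assms by (auto simp: ft_invariant_def)
  have "\<beta> * b < b"
    using assms ab by simp
  \<comment> \<open>The guard forces \<open>a < b\<close>, which excludes the collapsed alternative
    of the invariant.\<close>
  then have "a < b" and "xstar < b"
    using less inv by (auto simp: ft_invariant_def)
  have x: "a < x" "x < b"
    using sqrt_mult_between[OF \<open>0 < a\<close> \<open>a < b\<close>] by (simp_all add: x_def)
  have half: "ln (x / a) * 2 ^ Suc n \<le> ln (x\<^sub>0 / \<epsilon>)" "ln (b / x) * 2 ^ Suc n \<le> ln (x\<^sub>0 / \<epsilon>)"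
    unfolding x_def ln_sqrt_mult_divide[OF ab] using le by simp_all
  \<comment> \<open>This serves the case \<open>g x = 0\<close>: the new interval is a single point
    of logarithmic length 0, so its bound reads
    \<open>0 \<le> ln (x\<^sub>0 / \<epsilon>)\<close>.\<close>
  have "0 \<le> ln (b / a)"
    using ab a by simp
  then have "0 \<le> ln (x\<^sub>0 / \<epsilon>)"
    using le by (smt (verit) mult_nonneg_nonneg zero_le_power)
  moreover have "int (Suc n) \<le> max 0 \<lceil>log 2 (log \<beta> (\<epsilon> / x\<^sub>0))\<rceil>"
    using ft_invariant_count[OF assms(1-4) inv less] by linarith
  moreover have "x \<le> xstar" if "g x \<le> 0"
    using pos[of x] that x ab by force
  moreover have "xstar < x" if "0 < g x"
    using nonpos[of x] that x ab by force
  ultimately show ?thesis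
    using half a ab x \<open>xstar < b\<close>
    unfolding x_def[symmetric] ft_invariant_def ft_update_def
    by (auto simp del: power_Suc)
qed

theorem theorem3p1:
  fixes g :: "real \<Rightarrow> real" and \<beta> \<epsilon> xstar x\<^sub>0 :: real
  assumes "0 < \<beta>" and "\<beta> < 1"
    and "0 < \<epsilon>" and "\<epsilon> < xstar" and "xstar < x\<^sub>0"
    and "\<And>x. 0 < x \<Longrightarrow> x \<le> xstar \<Longrightarrow> g x \<le> 0"
    and "\<And>x. 0 < x \<Longrightarrow> xstar < x \<Longrightarrow> g x > 0"
  shows "\<exists>xhat n.
      fast_tracking (\<lambda>a b. sqrt (a * b)) g \<epsilon> x\<^sub>0 \<beta> = Some (xhat, n)
    \<and> int n \<le> max 0 \<lceil>log 2 (log \<beta> (\<epsilon> / x\<^sub>0))\<rceil>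
    \<and> g xhat \<le> 0
    \<and> xhat \<le> xstar
    \<and> ((\<forall>x. \<epsilon> < x \<and> x \<le> \<beta> * xstar \<longrightarrow> g x \<noteq> 0) \<longrightarrow> \<beta> * xstar < xhat)"
proof -
  let ?P = "ft_invariant g xstar \<epsilon> x\<^sub>0 \<beta>"
  let ?N = "nat \<lceil>log 2 (log \<beta> (\<epsilon> / x\<^sub>0))\<rceil>"
  let ?cond = "\<lambda>((a, b), n::nat). a < \<beta> * b"
  let ?body = "\<lambda>((a, b), n). (ft_update g (sqrt (a * b)) (a, b), Suc n)"
  have x0: "0 < x\<^sub>0"
    using assms(3-5) by linarith
  have init: "?P ((\<epsilon>, x\<^sub>0), 0)"
    using assms(3-5) by (simp add: ft_invariant_def)
  have step: "?P (?body s) \<and> ?N - snd (?body s) < ?N - snd s" if "?P s" and "?cond s" for s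
  proof -
    obtain a b n where s: "s = ((a, b), n)"
      by (metis prod.collapse)
    \<comment> \<open>Being strictly below \<open>?N\<close> on entry, \<open>n\<close> makes the
      truncated difference \<open>?N - n\<close> positive, so it really drops when \<open>n\<close>
      grows.\<close>
    have "int n < \<lceil>log 2 (log \<beta> (\<epsilon> / x\<^sub>0))\<rceil>"
      using ft_invariant_count[OF assms(1-3) x0] that s by auto
    then show ?thesis
      using ft_invariant_step[OF assms(1-3) x0 assms(6,7)] that s by auto
  qed
  obtain t where t: "while_option ?cond ?body ((\<epsilon>, x\<^sub>0), 0) = Some t"
    using measure_while_option_Some[of ?P ?cond ?body "\<lambda>s. ?N - snd s", OF step init]
    by blast
  have "?P t"
    using while_option_rule[of ?P ?cond ?body, OF _ t init] step by blast
  obtain a b n where tabn: "t = ((a, b), n)"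
    by (metis prod.collapse)
  have "\<beta> * b \<le> a"
    using while_option_stop[OF t] tabn by simp
  have inv: "\<epsilon> \<le> a" "a \<le> xstar" "xstar < b \<or> a = b \<and> \<epsilon> < a \<and> g a = 0"
    "int n \<le> max 0 \<lceil>log 2 (log \<beta> (\<epsilon> / x\<^sub>0))\<rceil>"
    using \<open>?P t\<close> tabn by (auto simp: ft_invariant_def)
  \<comment> \<open>Without a collapse, the failed guard gives
    \<open>\<beta> * xstar < \<beta> * b \<le> a\<close>. After one, \<open>a\<close> is a zero of
    \<open>g\<close> above \<open>\<epsilon>\<close>, which the assumption keeps out of the range up
    to \<open>\<beta> * xstar\<close>.\<close>
  have "\<beta> * xstar < a" if "\<forall>x. \<epsilon> < x \<and> x \<le> \<beta> * xstar \<longrightarrow> g x \<noteq> 0"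
    using inv(3)
  proof
    assume "xstar < b"
    then have "\<beta> * xstar < \<beta> * b"
      using assms(1) by simp
    then show ?thesis
      using \<open>\<beta> * b \<le> a\<close> by linarith
  qed (use that not_le in blast)
  moreover have "fast_tracking (\<lambda>a b. sqrt (a * b)) g \<epsilon> x\<^sub>0 \<beta> = Some (a, n)"
    using t tabn by (simp add: fast_tracking_def)
  ultimately show ?thesis
    using inv assms(3) assms(6)[of a] by auto
qed

end
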